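(* Let $A=\begin{pmatrix} a_{11} & a_{12}\\ a_{21} & a_{22}\end{pmatrix}$ be a real matrix, and let $m_R=\tfrac12(a_{11}+a_{22})$ and $p=\tfrac12\sqrt{(a_{11}-a_{22})^2+(a_{12}+a_{21})^2}$. Then the system $\frac{dX}{dt}=AX$ on $\mathbb{R}^2$ has reactivity $\rho_1=m_R+p$ and attenuation $\rho_2=m_R-p$.
   Context: For $X_0\in\mathbb{R}^2$ let $X(t)$ be the solution of $\frac{dX}{dt}=AX$ with $X(0)=X_0$, let $r(t)=\|X(t)\|$ (Euclidean norm) and $r_0=\|X_0\|$. The reactivity of the system is $\max_{X_0\ne0}\left(\frac1{r_0}\frac{dr}{dt}\Big|_{t=0}\right)$, and its attenuation is $\min_{X_0\ne0}\left(\frac1{r_0}\frac{dr}{dt}\Big|_{t=0}\right)$. *)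

theory Defs
  imports "HOL-Analysis.Analysis"
begin

definition linear_ivp_solution :: "real^2^2 \<Rightarrow> real^2 \<Rightarrow> (real \<Rightarrow> real^2) \<Rightarrow> bool" where
  "linear_ivp_solution A X0 X \<longleftrightarrow>
     X 0 = X0 \<and> (\<forall>t. (X has_vector_derivative A *v X t) (at t))"

(* The values (1/r0) * dr/dt at t = 0, for r(t) = norm (X t). The derivative is relational, so no
   default value of deriv can enter. X ranges over all solutions with initial value X0; by
   existence and uniqueness for linear systems there is exactly one. *)
definition initial_growth_rates :: "real^2^2 \<Rightarrow> real set" where
  "initial_growth_rates A =
     {1 / norm X0 * r' | X0 X r'.
        X0 \<noteq> 0 \<and> linear_ivp_solution A X0 X \<and>
        ((\<lambda>t. norm (X t)) has_real_derivative r') (at 0)}"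

(* Maximum and minimum, not supremum and infimum: the value has to be attained. *)
definition has_reactivity :: "real^2^2 \<Rightarrow> real \<Rightarrow> bool" where
  "has_reactivity A \<rho> \<longleftrightarrow>
     \<rho> \<in> initial_growth_rates A \<and> (\<forall>s \<in> initial_growth_rates A. s \<le> \<rho>)"

definition has_attenuation :: "real^2^2 \<Rightarrow> real \<Rightarrow> bool" where
  "has_attenuation A \<rho> \<longleftrightarrow>
     \<rho> \<in> initial_growth_rates A \<and> (\<forall>s \<in> initial_growth_rates A. \<rho> \<le> s)"

end

theory Submission
  imports Defs
begin

text \<open>
  Since \<open>d/dt \<parallel>X\<parallel> = (X \<bullet> A X) / \<parallel>X\<parallel>\<close>, the growth rates are the Rayleigh quotients of \<open>A\<close>. With
  \<open>h = (a11 - a22)/2\<close>, \<open>q = (a12 + a21)/2\<close> and \<open>z = u + i v\<close>, the quadratic form at \<open>(u, v)\<close> is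
  \<open>m\<^sub>R |z|\<^sup>2 + Re ((h - i q) z\<^sup>2)\<close>, which lies within \<open>|h + i q| |z|\<^sup>2 = p |z|\<^sup>2\<close> of \<open>m\<^sub>R |z|\<^sup>2\<close>; the
  bounds are attained where \<open>z\<^sup>2 = \<plusminus>(h + i q)\<close>.
\<close>

lemma matrix_vector_mult_2:
  fixes A :: "real^2^2"
  shows "(A *v x) $ 1 = A$1$1 * x$1 + A$1$2 * x$2"
    and "(A *v x) $ 2 = A$2$1 * x$1 + A$2$2 * x$2"
  by (simp_all add: matrix_vector_mult_def sum_2)

lemma cayley_hamilton_2:
  fixes A :: "real^2^2"
  shows "A *v (A *v x) = trace A *\<^sub>R (A *v x) - det A *\<^sub>R x"
  by (simp add: vec_eq_iff forall_2 matrix_vector_mult_2 trace_def sum_2 det_2 algebra_simps)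

text \<open>These are the coefficients of exp (t B) = c t I + s t B for a matrix B with B^2 = d I.
  Matching the derivative B exp (t B) forces c' = d s and s' = c. The sign of \<open>d\<close>
  decides between polynomial, hyperbolic and trigonometric solutions; dividing by \<open>w\<close>
  normalises s' to c.\<close>

lemma harmonic_system_exists:
  fixes d :: real
  obtains c s :: "real \<Rightarrow> real" where "c 0 = 1" "s 0 = 0"
    "\<And>t. (c has_real_derivative d * s t) (at t)" "\<And>t. (s has_real_derivative c t) (at t)"
proof -
  consider "d = 0" | "d > 0" | "d < 0" by linarith
  then show thesis
  proof cases
    case 1
    show ?thesis
      by (rule that[of "\<lambda>_. 1" "\<lambda>t. t"]) (use 1 in \<open>auto intro!: derivative_eq_intros\<close>)
  next
    case 2
    define w where "w = sqrt d"
    have w: "w > 0" "d = w * w" using 2 by (auto simp: w_def)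
    show ?thesis
      by (rule that[of "\<lambda>t. cosh (w * t)" "\<lambda>t. sinh (w * t) / w"])
        (use w in \<open>auto intro!: derivative_eq_intros\<close>)
  next
    case 3
    define w where "w = sqrt (- d)"
    have w: "w > 0" "d = - (w * w)" using 3 by (auto simp: w_def)
    show ?thesis
      by (rule that[of "\<lambda>t. cos (w * t)" "\<lambda>t. sin (w * t) / w"])
        (use w in \<open>auto intro!: derivative_eq_intros\<close>)
  qed
qed

text \<open>
  With \<open>m = trace A / 2\<close> and \<open>B = A - m I\<close>, the Cayley-Hamilton theorem gives \<open>B\<^sup>2 = (m\<^sup>2 - det A) I\<close>,
  hence \<open>exp (t A) = exp (m t) (c t I + s t B)\<close>.
\<close>

lemma linear_ivp_solution_exists:
  obtains X where "linear_ivp_solution A x X"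
proof -
  define m where "m = trace A / 2"
  define y where "y = A *v x - m *\<^sub>R x"
  define d where "d = m\<^sup>2 - det A"
  obtain c s :: "real \<Rightarrow> real" where cs: "c 0 = 1" "s 0 = 0"
    and [derivative_intros]: "\<And>t. (c has_real_derivative d * s t) (at t)"
      "\<And>t. (s has_real_derivative c t) (at t)"
    using harmonic_system_exists[of d] by metis
  have tr: "trace A = 2 * m" by (simp add: m_def)
  have Ax: "A *v x = m *\<^sub>R x + y" by (simp add: y_def)
  \<comment> \<open>Since y = B x, this says B y = d x. So the span of x and y is invariant under A,
    and solving the system reduces to scalar equations for the coefficients of x and y.\<close>
  have Ay: "A *v y = m *\<^sub>R y + d *\<^sub>R x"
    unfolding y_def matrix_vector_mult_diff_distrib matrix_vector_mult_scaleR cayley_hamilton_2 tr d_def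
    by (simp add: vec_eq_iff algebra_simps power2_eq_square)
  define X where "X = (\<lambda>t. (exp (m * t) * c t) *\<^sub>R x + (exp (m * t) * s t) *\<^sub>R y)"
  have "(X has_vector_derivative A *v X t) (at t)" for t
    unfolding X_def
    by (auto intro!: derivative_eq_intros
        simp: matrix_vector_right_distrib matrix_vector_mult_scaleR Ax Ay vec_eq_iff algebra_simps)
  then have "linear_ivp_solution A x X"
    by (simp add: linear_ivp_solution_def X_def cs)
  then show thesis by (rule that)
qed

text \<open>Chain rule: away from the origin the norm has derivative v -> v . sgn x at x, here
  applied to the initial velocity A x.\<close>

lemma norm_linear_ivp_solution_derivative:
  assumes "linear_ivp_solution A x X" "x \<noteq> 0"
  shows "((\<lambda>t. norm (X t)) has_real_derivative (x \<bullet> (A *v x)) / norm x) (at 0)"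
proof -
  have X0: "X 0 = x" and "(X has_vector_derivative A *v x) (at 0)"
    using assms(1) unfolding linear_ivp_solution_def by metis+
  then have X: "(X has_derivative (\<lambda>t. t *\<^sub>R (A *v x))) (at 0)"
    by (simp add: has_vector_derivative_def)
  have "(norm has_derivative (\<lambda>v. v \<bullet> sgn (X 0))) (at (X 0))"
    using assms(2) X0 by (intro has_derivative_norm) auto
  from has_derivative_compose[OF X this] show ?thesis
    unfolding has_field_derivative_def
    by (rule has_derivative_eq_rhs)
      (auto simp: fun_eq_iff X0 sgn_div_norm divide_inverse inner_commute)
qed

text \<open>Left to right, the derivative of the norm at 0 depends on the solution only through its
  initial value. Right to left, a Rayleigh quotient counts as a growth rate only because some
  solution starts at x.\<close>

lemma initial_growth_rates_eq:
  "initial_growth_rates A = {(x \<bullet> (A *v x)) / (norm x)\<^sup>2 | x. x \<noteq> 0}"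
proof (intro set_eqI iffI)
  fix r assume "r \<in> initial_growth_rates A"
  then obtain x X r' where r: "r = 1 / norm x * r'" "x \<noteq> 0" "linear_ivp_solution A x X"
    "((\<lambda>t. norm (X t)) has_real_derivative r') (at 0)"
    unfolding initial_growth_rates_def by blast
  then have "r' = (x \<bullet> (A *v x)) / norm x"
    using norm_linear_ivp_solution_derivative DERIV_unique by blast
  with r show "r \<in> {(x \<bullet> (A *v x)) / (norm x)\<^sup>2 | x. x \<noteq> 0}"
    by (auto simp: power2_eq_square)
next
  fix r assume "r \<in> {(x \<bullet> (A *v x)) / (norm x)\<^sup>2 | x. x \<noteq> 0}"
  then obtain x where x: "r = (x \<bullet> (A *v x)) / (norm x)\<^sup>2" "x \<noteq> 0" by blast
  obtain X where X: "linear_ivp_solution A x X" by (rule linear_ivp_solution_exists)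
  have "r = 1 / norm x * ((x \<bullet> (A *v x)) / norm x)"
    using x(1) by (simp add: power2_eq_square)
  with x(2) X norm_linear_ivp_solution_derivative[OF X x(2)] show "r \<in> initial_growth_rates A"
    unfolding initial_growth_rates_def by blast
qed

lemma quadratic_form_bound:
  fixes h q u v :: real
  shows "\<bar>h * (u\<^sup>2 - v\<^sup>2) + q * (2 * u * v)\<bar> \<le> sqrt (h\<^sup>2 + q\<^sup>2) * (u\<^sup>2 + v\<^sup>2)"
proof -
  have "h * (u\<^sup>2 - v\<^sup>2) + q * (2 * u * v) = Re (Complex h (- q) * (Complex u v)\<^sup>2)"
    by (simp add: complex_mult power2_eq_square)
  then have "\<bar>h * (u\<^sup>2 - v\<^sup>2) + q * (2 * u * v)\<bar> \<le> cmod (Complex h (- q) * (Complex u v)\<^sup>2)"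
    by (metis abs_Re_le_cmod)
  also have "\<dots> = sqrt (h\<^sup>2 + q\<^sup>2) * (u\<^sup>2 + v\<^sup>2)"
    by (simp add: norm_mult norm_power complex_norm)
  finally show ?thesis .
qed

text \<open>The sign \<open>e\<close> treats maximum and minimum at once. If z^2 = e (h + i q), then
  (h - i q) z^2 = e (h^2 + q^2) is real and |z|^2 = |h + i q|, so both sides equal e (h^2 +
  q^2).\<close>

lemma quadratic_form_bound_attained:
  fixes h q e :: real
  assumes "\<bar>e\<bar> = 1"
  obtains u v :: real where "u\<^sup>2 + v\<^sup>2 > 0"
    "h * (u\<^sup>2 - v\<^sup>2) + q * (2 * u * v) = e * sqrt (h\<^sup>2 + q\<^sup>2) * (u\<^sup>2 + v\<^sup>2)"
proof (cases "h = 0 \<and> q = 0")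
  case True
  \<comment> \<open>Here the square root would be z = 0, which is not admissible; the form vanishes,
    so any nonzero vector serves.\<close>
  then show thesis using that[of 1 0] by simp
next
  case False
  define z where "z = csqrt (e * Complex h q)"
  define u v where "u = Re z" and "v = Im z"
  have z2: "z\<^sup>2 = e * Complex h q" by (simp add: z_def)
  have re: "u\<^sup>2 - v\<^sup>2 = e * h" and im: "2 * u * v = e * q"
    using arg_cong[OF z2, of Re] arg_cong[OF z2, of Im]
    by (simp_all add: u_def v_def power2_eq_square mult_ac)
  have "u\<^sup>2 + v\<^sup>2 = cmod (z\<^sup>2)"
    by (simp add: norm_power cmod_power2 u_def v_def)
  also have "\<dots> = sqrt (h\<^sup>2 + q\<^sup>2)"
    using assms by (simp add: z2 norm_mult complex_norm)
  finally have n: "u\<^sup>2 + v\<^sup>2 = sqrt (h\<^sup>2 + q\<^sup>2)" .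
  show thesis
  proof (rule that)
    show "u\<^sup>2 + v\<^sup>2 > 0" using False by (simp add: n sum_power2_gt_zero_iff)
    show "h * (u\<^sup>2 - v\<^sup>2) + q * (2 * u * v) = e * sqrt (h\<^sup>2 + q\<^sup>2) * (u\<^sup>2 + v\<^sup>2)"
      by (simp add: re im n) (simp add: power2_eq_square algebra_simps)
  qed
qed

theorem theorem3p1:
  fixes a11 a12 a21 a22 m\<^sub>R p :: real and A :: "real^2^2"
  assumes "A = vector [vector [a11, a12], vector [a21, a22]]"
    and "m\<^sub>R = 1/2 * (a11 + a22)"
    and "p = 1/2 * sqrt ((a11 - a22)\<^sup>2 + (a12 + a21)\<^sup>2)"
  shows "has_reactivity A (m\<^sub>R + p) \<and> has_attenuation A (m\<^sub>R - p)"
proof -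
  \<comment> \<open>The symmetric part of A, which alone determines x . A x, is
    \<open>m\<^sub>R\<close> I plus the traceless matrix with rows (h, q) and (q, -h).\<close>
  define h q where "h = (a11 - a22) / 2" and "q = (a12 + a21) / 2"
  have "h\<^sup>2 + q\<^sup>2 = ((a11 - a22)\<^sup>2 + (a12 + a21)\<^sup>2) / 2\<^sup>2"
    by (simp add: h_def q_def power2_eq_square field_simps)
  then have p: "p = sqrt (h\<^sup>2 + q\<^sup>2)"
    by (simp only: assms(3) real_sqrt_divide) simp
  have nrm: "(norm x)\<^sup>2 = (x$1)\<^sup>2 + (x$2)\<^sup>2" for x :: "real^2"
    unfolding power2_norm_eq_inner by (simp add: inner_vec_def sum_2 power2_eq_square)
  have form: "x \<bullet> (A *v x) =
      m\<^sub>R * (norm x)\<^sup>2 + (h * ((x$1)\<^sup>2 - (x$2)\<^sup>2) + q * (2 * x$1 * x$2))" for x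
    unfolding nrm
    by (simp add: inner_vec_def sum_2 matrix_vector_mult_2 assms(1,2) h_def q_def)
      (simp add: field_simps power2_eq_square)
  have bound: "\<bar>s - m\<^sub>R\<bar> \<le> p" if "s \<in> initial_growth_rates A" for s
  proof -
    obtain x where x: "s = (x \<bullet> (A *v x)) / (norm x)\<^sup>2" "x \<noteq> 0"
      using \<open>s \<in> _\<close> by (auto simp: initial_growth_rates_eq)
    have "\<bar>x \<bullet> (A *v x) - m\<^sub>R * (norm x)\<^sup>2\<bar> \<le> p * (norm x)\<^sup>2"
      using quadratic_form_bound[of h "x$1" "x$2" q] by (simp add: form p nrm)
    moreover have "x \<bullet> (A *v x) - m\<^sub>R * (norm x)\<^sup>2 = (s - m\<^sub>R) * (norm x)\<^sup>2"
      using x by (simp add: field_simps)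
    ultimately show ?thesis using x(2) by (simp add: abs_mult)
  qed
  \<comment> \<open>e = 1 yields the reactivity and e = -1 the attenuation; \<open>bound\<close>
    likewise covers both sides.\<close>
  have attained: "m\<^sub>R + e * p \<in> initial_growth_rates A" if "\<bar>e\<bar> = 1" for e
  proof -
    obtain u v where uv: "u\<^sup>2 + v\<^sup>2 > 0"
      "h * (u\<^sup>2 - v\<^sup>2) + q * (2 * u * v) = e * p * (u\<^sup>2 + v\<^sup>2)"
      using quadratic_form_bound_attained[OF \<open>\<bar>e\<bar> = 1\<close>, of h q] p by metis
    define x :: "real^2" where "x = vector [u, v]"
    have n: "(norm x)\<^sup>2 = u\<^sup>2 + v\<^sup>2" by (simp add: nrm x_def)
    have "x \<bullet> (A *v x) = (m\<^sub>R + e * p) * (norm x)\<^sup>2"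
      using uv(2) by (simp add: form n) (simp add: x_def algebra_simps)
    moreover have "x \<noteq> 0" using n uv(1) by auto
    ultimately show ?thesis by (force simp: initial_growth_rates_eq)
  qed
  show ?thesis
    using attained[of 1] attained[of "-1"] bound
    unfolding has_reactivity_def has_attenuation_def by (force simp: abs_le_iff)
qed

end
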